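(* Let $W=\begin{bmatrix} a_1 & \cdots & a_N\\ b_1 & \cdots & b_N\end{bmatrix}$ be an integer weight matrix whose columns lie in a strictly convex cone in $\mathbb{R}^2$ and which satisfies conditions (1)--(4) given in the context. Let $a=\sum_{i=1}^N a_i$, $b=\sum_{i=1}^N b_i$, let $X$ be the associated Fano toric variety, let $e_1,\dots,e_N\in\mathbb{Z}^{N-2}$ be the associated vectors, let $P=\mathrm{conv}\{e_1,\dots,e_N\}\subset\mathbb{R}^{N-2}$, and let $\Delta_i=\mathrm{conv}\{e_j : j\ne i\}$. Let $s_+=\{i : a_ib-b_ia>0\}$ and $s_-=\{i : a_ib-b_ia<0\}$, and let $I$ be either $s_+$ or $s_-$. Then the simplices $\Delta_i$, $i\in I$, form a triangulation of $P$, and $X$ has terminal singularities if and only if $\Delta_i$ is mostly empty for each $i\in I$.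
   Context: Weight matrix: a $2\times N$ integer matrix $W$ whose columns $D_i=(a_i,b_i)$ all lie in a strictly convex cone in $\mathbb{R}^2$ (a closed convex cone containing no line). The conditions on $W$ are: (1) None of the columns is the zero vector. (2) The sum of the columns $(a,b)$ is not a (real) multiple of any of the columns. (3) The subspaces $S_+=\{z\in\mathbb{C}^N : z_i=0 \text{ if } b_i/a_i>b/a\}$ and $S_-=\{z\in\mathbb{C}^N : z_i=0 \text{ if } b_i/a_i<b/a\}$ both have dimension at least two. Here $b_i/a_i>b/a$ (resp. $<$) is understood as $a b_i-b a_i>0$ (resp. $<0$). (4) $W$ is well-formed: for every $i$, the $2\times(N-1)$ matrix obtained by deleting the $i$th column of $W$ has the property that the greatest common divisor of its $2\times 2$ minors is one. The vectors $e_1,\dots,e_N$: the kernel of $W:\mathbb{Z}^N\to\mathbb{Z}^2$ is a free $\mathbb{Z}$-module of rank $N-2$; choosing a basis gives an $N\times(N-2)$ integer matrix $M$ whose columns are this basis, so $WM=0$. Then $e_1,\dots,e_N\in\mathbb{Z}^{N-2}$ are the rows of $M$ (well defined up to $\mathrm{GL}_{N-2}(\mathbb{Z})$). They satisfy $\sum_i a_ie_i=0$ and $\sum_i b_ie_i=0$. The toric variety $X$: put $\omega=(a,b)$. For $J\subset\{1,\dots,N\}$ let $\angle_J=\{\sum_{i\in J}\lambda_iD_i : \lambda_i\in\mathbb{R}_{>0}\}$, and let $\mathcal{A}_\omega=\{J\subset\{1,\dots,N\} : \omega\in\angle_J\}$. The fan of $X$ in $\mathbb{R}^{N-2}$ with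 lattice $\mathbb{Z}^{N-2}$ is $\Sigma(X)=\{\sigma_J : \bar J\in\mathcal{A}_\omega\}$, where $\sigma_J=\mathrm{cone}\{e_i : i\in J\}$ and $\bar J$ is the complement of $J$ in $\{1,\dots,N\}$. $X$ is the toric variety of this fan; equivalently $X=(\mathbb{C}^N\setminus(S_+\cup S_-))/(\mathbb{C}^\times)^2$ with action $(\lambda,\mu)\cdot(z_1,\dots,z_N)=(\lambda^{a_1}\mu^{b_1}z_1,\dots,\lambda^{a_N}\mu^{b_N}z_N)$. It is a $\mathbb{Q}$-factorial Fano toric variety of dimension $N-2$ and Picard rank two, and $e_1,\dots,e_N$ are the first lattice points on the rays of $\Sigma(X)$ and are the vertices of $P$. Terminality: $X$ has terminal singularities if and only if, for every top-dimensional cone $\sigma$ of $\Sigma(X)$, with $H$ the hyperplane containing its $N-2$ primitive generators, the only lattice points of $\sigma$ on or below $H$ (that is, on $H$ or on the same side of it as the origin) are these generators and the origin; equivalently, the only lattice points of $P$ are its vertices and the origin. The simplex $\Delta_i$ is called mostly empty if each lattice point (point of $\mathbb{Z}^{N-2}$) in $\Delta_i$ is either a vertex of $\Delta_i$ or the origin. *)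

theory Defs
  imports "HOL-Analysis.Analysis"
begin

section \<open>Weight matrices\<close>

definition weight :: "int^'n^2 \<Rightarrow> 'n::finite \<Rightarrow> real^2" where
  "weight W i = (\<chi> r. real_of_int (W $ r $ i))"

definition sum_a :: "int^'n^2 \<Rightarrow> int" where
  "sum_a W = (\<Sum>i\<in>UNIV. W $ 1 $ i)"

definition sum_b :: "int^'n^2 \<Rightarrow> int" where
  "sum_b W = (\<Sum>i\<in>UNIV. W $ 2 $ i)"

definition omega :: "int^'n^2 \<Rightarrow> real^2" where
  "omega W = (\<chi> r. real_of_int (if r = 1 then sum_a W else sum_b W))"

definition strictly_convex_cone :: "'a::real_normed_vector set \<Rightarrow> bool" where
  "strictly_convex_cone C \<longleftrightarrow>
     closed C \<and> convex_cone C \<and> \<not> (\<exists>p v. v \<noteq> 0 \<and> (\<forall>t::real. p + t *\<^sub>R v \<in> C))"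

definition S_plus :: "int^'n^2 \<Rightarrow> (complex^'n) set" where
  "S_plus W = {z. \<forall>i. sum_a W * W $ 2 $ i - sum_b W * W $ 1 $ i > 0 \<longrightarrow> z $ i = 0}"

definition S_minus :: "int^'n^2 \<Rightarrow> (complex^'n) set" where
  "S_minus W = {z. \<forall>i. sum_a W * W $ 2 $ i - sum_b W * W $ 1 $ i < 0 \<longrightarrow> z $ i = 0}"

text \<open>The index type carries no order, so every minor is listed with both signs; this does not
  affect the greatest common divisor.\<close>

definition well_formed :: "int^'n^2 \<Rightarrow> bool" where
  "well_formed W \<longleftrightarrow>
     (\<forall>i. Gcd {W $ 1 $ j * W $ 2 $ k - W $ 1 $ k * W $ 2 $ j | j k.
               j \<noteq> i \<and> k \<noteq> i \<and> j \<noteq> k} = 1)"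

text \<open>With the sign convention below, the coordinates that vanish on \<^const>\<open>S_plus\<close> are those in
  \<open>s_minus\<close>, and vice versa.\<close>

definition s_plus :: "int^'n^2 \<Rightarrow> 'n set" where
  "s_plus W = {i. W $ 1 $ i * sum_b W - W $ 2 $ i * sum_a W > 0}"

definition s_minus :: "int^'n^2 \<Rightarrow> 'n set" where
  "s_minus W = {i. W $ 1 $ i * sum_b W - W $ 2 $ i * sum_a W < 0}"


section \<open>The vectors \<open>e\<^sub>i\<close> and the associated simplices\<close>

definition kernel_basis :: "int^'n^2 \<Rightarrow> int^'m^'n \<Rightarrow> bool" where
  "kernel_basis W M \<longleftrightarrow>
     (\<forall>k. W *v column k M = 0) \<and>
     (\<forall>x. W *v x = 0 \<longrightarrow> (\<exists>!c :: int^'m. x = (\<Sum>k\<in>UNIV. c $ k *s column k M)))"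

definition evec :: "int^'m^'n \<Rightarrow> 'n \<Rightarrow> real^'m" where
  "evec M i = (\<chi> k. real_of_int (row i M $ k))"

definition polytope_P :: "int^'m^'n \<Rightarrow> (real^'m) set" where
  "polytope_P M = convex hull (range (evec M))"

definition Delta :: "int^'m^'n \<Rightarrow> 'n \<Rightarrow> (real^'m) set" where
  "Delta M i = convex hull {evec M j | j. j \<noteq> i}"

definition lattice_points :: "(real^'m) set" where
  "lattice_points = {x. \<forall>k. x $ k \<in> \<int>}"

definition mostly_empty :: "(real^'m) set \<Rightarrow> bool" where
  "mostly_empty S \<longleftrightarrow> (\<forall>x \<in> lattice_points \<inter> S. x extreme_point_of S \<or> x = 0)"

text \<open>An indexed family of full-dimensional simplices triangulating a set; distinct indices give
  distinct simplices.\<close>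

definition triangulates :: "('i \<Rightarrow> (real^'m) set) \<Rightarrow> 'i set \<Rightarrow> (real^'m) set \<Rightarrow> bool" where
  "triangulates T I S \<longleftrightarrow>
     (\<forall>i\<in>I. int CARD('m) simplex T i) \<and> inj_on T I \<and> triangulation (T ` I) \<and> (\<Union>i\<in>I. T i) = S"


section \<open>The fan of the toric variety and terminality\<close>

definition open_cone :: "int^'n^2 \<Rightarrow> 'n set \<Rightarrow> (real^2) set" where
  "open_cone W J = {\<Sum>i\<in>J. l i *\<^sub>R weight W i | l. \<forall>i\<in>J. l i > (0::real)}"

definition A_omega :: "int^'n^2 \<Rightarrow> 'n set set" where
  "A_omega W = {J. omega W \<in> open_cone W J}"

definition sigma :: "int^'m^'n \<Rightarrow> 'n set \<Rightarrow> (real^'m) set" where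
  "sigma M J = convex_cone hull (evec M ` J)"

definition fan_X :: "int^'n^2 \<Rightarrow> int^'m^'n \<Rightarrow> (real^'m) set set" where
  "fan_X W M = {sigma M J | J. - J \<in> A_omega W}"

text \<open>The first nonzero lattice points on the extremal rays of a cone.\<close>

definition primitive_generators :: "(real^'m) set \<Rightarrow> (real^'m) set" where
  "primitive_generators \<sigma> =
     {v \<in> lattice_points. v \<noteq> 0 \<and> (convex_cone hull {v}) face_of \<sigma> \<and>
        (\<forall>t. 0 < t \<and> t < 1 \<longrightarrow> t *\<^sub>R v \<notin> lattice_points)}"

text \<open>Terminality of the toric variety of a complete fan (with respect to the standard lattice),
  through the usual toric criterion, since algebraic varieties and discrepancies are not
  available in the library.  The hyperplane \<open>H\<close> through the primitive generators of \<open>\<sigma>\<close> is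
  \<open>{x. u \<bullet> x = 1}\<close>, so the points on \<open>H\<close> or on the side of the origin are those with
  \<open>u \<bullet> x \<le> 1\<close>.  For a top-dimensional strictly convex rational cone such a \<open>u\<close> is unique if it
  exists; its existence is the \<open>\<rat>\<close>-Gorenstein condition, part of the definition of terminal.\<close>

definition toric_terminal :: "(real^'m) set set \<Rightarrow> bool" where
  "toric_terminal \<Sigma> \<longleftrightarrow>
     (\<forall>\<sigma>\<in>\<Sigma>. dim \<sigma> = CARD('m) \<longrightarrow>
        (\<exists>u. (\<forall>v\<in>primitive_generators \<sigma>. u \<bullet> v = 1) \<and>
             (\<forall>x \<in> \<sigma> \<inter> lattice_points. u \<bullet> x \<le> 1 \<longrightarrow>
                 x \<in> primitive_generators \<sigma> \<or> x = 0)))"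

end

theory Submission
  imports Defs
begin

text \<open>
  Both halves of the theorem are about one vector configuration. Put \<open>n = m + 2\<close> for the number
  of columns. The integral kernel of \<open>W\<close> contains, for any three columns, the vector of Cramer's
  dependence between them, whose entries are \<open>2 \<times> 2\<close> minors. Orthogonality to these vectors shows
  that the linear relations between the \<open>e i\<close> are exactly the functions \<open>i \<mapsto> f (D i)\<close> for
  linear functionals \<open>f\<close> on the plane (\<open>relation_in_row_space\<close>). Two functionals are singled out:
  \<open>d i = det (D i, \<omega>)\<close>, called \<open>slope\<close>, whose values sum to zero, and a functional \<open>p\<close> that is
  positive on all columns, which exists because the columns lie in a strictly convex cone.

  Up to scaling, \<open>d\<close> is the only affine relation, and none of its entries is zero because \<open>\<omega>\<close>
  is not a multiple of a column. So the \<open>n\<close> points form a circuit: any \<open>n - 1\<close> of them span a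
  simplex, and the two triangulations of \<open>P\<close> omit, one at a time, the points with \<open>d i > 0\<close> or those with \<open>d i < 0\<close>
  (\<open>circuit_triangulates\<close>). A point of \<open>P\<close> is placed in a simplex by subtracting multiples of
  \<open>d\<close> from its coefficients until one of them reaches zero. By the dimensions of \<open>S_plus\<close> and
  \<open>S_minus\<close> each sign occurs at least twice, so every \<open>e i\<close> is a vertex of \<open>P\<close> (\<open>vertex_extreme\<close>).

  The top-dimensional cones of the fan are spanned by all \<open>e j\<close> except one with \<open>d i > 0\<close> and one
  with \<open>d k < 0\<close> (\<open>fan_top_cones\<close>). Well-formedness makes the \<open>e j\<close> primitive
  (\<open>evec_primitive\<close>), so they are the primitive generators of these cones. The part of such a
  cone on or below the hyperplane through the generators is the simplex spanned by the generators
  and the origin, and these simplices cover \<open>P\<close>: subtracting a suitable \<open>s p + t d\<close> with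
  \<open>s \<ge> 0\<close> from convex coefficients makes one coefficient of each sign zero and does not
  increase their sum (\<open>hull_point_in_cone\<close>).

  Hence \<open>P\<close> is covered in two ways by simplices, and since all \<open>e i\<close> are vertices of \<open>P\<close>, both
  terminality and mostly emptiness say that the lattice points of \<open>P\<close> are its vertices and the
  origin (\<open>terminal_iff_hull_lattice_points\<close>, \<open>mostly_empty_simplices_iff\<close>).
\<close>

section \<open>Convex hulls and convex cones of finite families\<close>

lemma convex_hull_image_iff:
  fixes e :: "'n::finite \<Rightarrow> 'a::real_vector"
  shows "x \<in> convex hull (e ` J) \<longleftrightarrow>
    (\<exists>c. (\<forall>i. 0 \<le> c i) \<and> (\<forall>i. i \<notin> J \<longrightarrow> c i = 0) \<and> sum c UNIV = 1 \<and> x = (\<Sum>i\<in>UNIV. c i *\<^sub>R e i))"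
    (is "_ \<longleftrightarrow> ?R x")
proof
  assume x: "x \<in> convex hull (e ` J)"
  have "convex hull (e ` J) \<subseteq> {x. ?R x}"
  proof (rule hull_minimal)
    show "e ` J \<subseteq> {x. ?R x}"
    proof clarify
      fix j assume "j \<in> J"
      then show "?R (e j)"
        by (intro exI[of _ "\<lambda>i. if i = j then 1 else 0"])
           (auto simp: if_distrib[of "\<lambda>a. a *\<^sub>R _"] cong: if_cong)
    qed
    show "convex {x. ?R x}"
    proof (rule convexI, clarify)
      fix u v :: real and c c' :: "'n \<Rightarrow> real"
      assume "0 \<le> u" "0 \<le> v" "u + v = 1" "\<forall>i. 0 \<le> c i" "\<forall>i. i \<notin> J \<longrightarrow> c i = 0"
        "sum c UNIV = 1" "\<forall>i. 0 \<le> c' i" "\<forall>i. i \<notin> J \<longrightarrow> c' i = 0" "sum c' UNIV = 1"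
      then show "?R (u *\<^sub>R (\<Sum>i\<in>UNIV. c i *\<^sub>R e i) + v *\<^sub>R (\<Sum>i\<in>UNIV. c' i *\<^sub>R e i))"
        by (intro exI[of _ "\<lambda>i. u * c i + v * c' i"])
           (auto simp: sum.distrib sum_distrib_left[symmetric] scaleR_sum_right scaleR_add_left)
    qed
  qed
  with x show "?R x" by blast
next
  assume "?R x"
  then obtain c where c: "\<forall>i. 0 \<le> c i" "\<forall>i. i \<notin> J \<longrightarrow> c i = 0" "sum c UNIV = 1"
    "x = (\<Sum>i\<in>UNIV. c i *\<^sub>R e i)" by blast
  have s: "sum c J = 1"
    using c(2,3) by (metis (no_types, lifting) DiffE finite subset_UNIV sum.mono_neutral_right)
  have "x = (\<Sum>i\<in>J. c i *\<^sub>R e i)"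
    unfolding c(4) using c(2) by (intro sum.mono_neutral_right) auto
  also have "\<dots> \<in> convex hull (e ` J)"
    using c(1) s by (intro convex_sum) (auto intro: hull_inc)
  finally show "x \<in> convex hull (e ` J)" .
qed

lemma convex_cone_hull_image_iff:
  assumes "finite J"
  shows "x \<in> convex_cone hull (e ` J) \<longleftrightarrow>
    (\<exists>c. (\<forall>i\<in>J. 0 \<le> c i) \<and> x = (\<Sum>i\<in>J. c i *\<^sub>R e i))" (is "_ \<longleftrightarrow> ?R x")
proof
  assume x: "x \<in> convex_cone hull (e ` J)"
  have "convex_cone hull (e ` J) \<subseteq> {x. ?R x}"
  proof (rule hull_minimal)
    show "e ` J \<subseteq> {x. ?R x}"
    proof clarify
      fix j assume "j \<in> J"
      then show "?R (e j)" using assms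
        by (intro exI[of _ "\<lambda>i. if i = j then 1 else 0"])
           (auto simp: if_distrib[of "\<lambda>a. a *\<^sub>R _"] cong: if_cong)
    qed
    show "convex_cone {x. ?R x}"
      unfolding convex_cone_iff
    proof (intro conjI ballI allI impI)
      show "0 \<in> {x. ?R x}"
        by (auto intro: exI[of _ "\<lambda>_. 0"])
    next
      fix x y assume "x \<in> {x. ?R x}" "y \<in> {x. ?R x}"
      then obtain c c' where "\<forall>i\<in>J. 0 \<le> c i" "\<forall>i\<in>J. 0 \<le> c' i"
        "x = (\<Sum>i\<in>J. c i *\<^sub>R e i)" "y = (\<Sum>i\<in>J. c' i *\<^sub>R e i)" by blast
      then have "?R (x + y)"
        by (intro exI[of _ "\<lambda>i. c i + c' i"]) (auto simp: sum.distrib scaleR_add_left)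
      then show "x + y \<in> {x. ?R x}" by simp
    next
      fix x and u :: real assume "x \<in> {x. ?R x}" "0 \<le> u"
      then obtain c where "\<forall>i\<in>J. 0 \<le> c i" "x = (\<Sum>i\<in>J. c i *\<^sub>R e i)" by blast
      with \<open>0 \<le> u\<close> have "?R (u *\<^sub>R x)"
        by (intro exI[of _ "\<lambda>i. u * c i"]) (auto simp: scaleR_sum_right)
      then show "u *\<^sub>R x \<in> {x. ?R x}" by simp
    qed
  qed
  with x show "?R x" by blast
next
  assume "?R x"
  then obtain c where c: "\<forall>i\<in>J. 0 \<le> c i" and x: "x = (\<Sum>i\<in>J. c i *\<^sub>R e i)" by blast
  have *: "convex_cone (convex_cone hull (e ` J))" by (rule convex_cone_convex_cone_hull)
  have "(\<Sum>i\<in>K. c i *\<^sub>R e i) \<in> convex_cone hull (e ` J)" if "K \<subseteq> J" for K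
    using finite_subset[OF that assms] that
  proof (induction K rule: finite_induct)
    case empty
    then show ?case by (simp add: convex_cone_hull_contains_0)
  next
    case (insert k K)
    then show ?case using c
      by (simp add: convex_cone_hull_add convex_cone_hull_mul hull_inc)
  qed
  then show "x \<in> convex_cone hull (e ` J)" unfolding x by blast
qed

lemma independent_dual_vector:
  fixes B :: "'a::euclidean_space set"
  assumes "independent B"
  shows "\<exists>u. \<forall>v\<in>B. u \<bullet> v = f v"
proof -
  obtain g :: "'a \<Rightarrow> real" where g: "linear g" "\<forall>v\<in>B. g v = f v"
    using linear_independent_extend[OF assms, of f] by blast
  have "adjoint g 1 \<bullet> v = g v" for v
    using adjoint_works[OF g(1), of v 1] by (simp add: inner_commute)
  with g(2) show ?thesis by metis
qed

text \<open>This recognises the part of a simplicial cone on or below the hyperplane through its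
  generators as the simplex spanned by the generators and the origin.\<close>

lemma sum_in_hull_insert_0:
  fixes e :: "'n \<Rightarrow> 'a::real_vector"
  assumes fin: "finite J" and c: "\<And>i. i \<in> J \<Longrightarrow> 0 \<le> c i" and s: "sum c J \<le> 1"
  shows "(\<Sum>i\<in>J. c i *\<^sub>R e i) \<in> convex hull (insert 0 (e ` J))"
proof (cases "sum c J = 0")
  case True
  then have "\<forall>i\<in>J. c i = 0" using fin c by (simp add: sum_nonneg_eq_0_iff)
  then have "(\<Sum>i\<in>J. c i *\<^sub>R e i) = 0" by simp
  then show ?thesis by (simp add: hull_inc)
next
  case False
  let ?s = "sum c J"
  have s0: "?s > 0" using False c by (metis less_eq_real_def sum_nonneg)
  have "(\<Sum>i\<in>J. (c i / ?s) *\<^sub>R e i) \<in> convex hull (insert 0 (e ` J))"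
    using fin s0 c by (intro convex_sum) (auto simp: hull_inc simp flip: sum_divide_distrib)
  then have "?s *\<^sub>R (\<Sum>i\<in>J. (c i / ?s) *\<^sub>R e i) + (1 - ?s) *\<^sub>R 0 \<in> convex hull (insert 0 (e ` J))"
    using s s0 by (intro convexD[OF convex_convex_hull]) (auto simp: hull_inc)
  then show ?thesis using s0 by (simp add: scaleR_sum_right)
qed

lemma dim_convex_cone_hull_le:
  fixes B :: "'a::euclidean_space set"
  assumes "finite B"
  shows "dim (convex_cone hull B) \<le> card B"
proof -
  have "convex_cone hull B \<subseteq> span B"
    by (rule hull_minimal) (auto simp: span_superset convex_cone_iff span_zero span_add span_scale)
  then show ?thesis using assms by (rule dim_le_card)
qed

text \<open>If the origin were a convex combination of the vectors, then minus one of them would be in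
  the cone, which would contain a line.\<close>

lemma strictly_convex_cone_positive_functional:
  fixes S :: "'a::euclidean_space set"
  assumes C: "strictly_convex_cone C" and S: "S \<subseteq> C" "finite S" "0 \<notin> S"
  shows "\<exists>a. \<forall>x\<in>S. a \<bullet> x > 0"
proof -
  have cone: "convex_cone C" using C by (simp add: strictly_convex_cone_def)
  have "0 \<notin> convex hull S"
  proof
    assume "0 \<in> convex hull S"
    then obtain u where u: "\<forall>x\<in>S. 0 \<le> u x" "sum u S = 1" "(\<Sum>x\<in>S. u x *\<^sub>R x) = 0"
      using convex_hull_finite[OF S(2)] by auto
    have "\<exists>v\<in>S. u v \<noteq> 0" using u(2) by (metis sum.neutral zero_neq_one)
    then obtain v where v: "v \<in> S" "u v > 0" using u(1) by force
    have "(\<Sum>x\<in>S-{v}. u x *\<^sub>R x) \<in> convex_cone hull (id ` (S - {v}))"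
      unfolding convex_cone_hull_image_iff[OF finite_Diff[OF S(2)]] using u(1)
      by (intro exI[of _ u]) auto
    also have "\<dots> \<subseteq> C" using S(1) cone by (intro hull_minimal) auto
    finally have "- (u v *\<^sub>R v) \<in> C"
      using u(3) sum.remove[OF S(2) v(1), of "\<lambda>x. u x *\<^sub>R x"] by (simp add: add_eq_0_iff)
    have "0 + t *\<^sub>R v \<in> C" for t
    proof (cases "t \<ge> 0")
      case True
      then show ?thesis using cone v(1) S(1) by (auto intro: convex_cone_scaleR)
    next
      case False
      then have "(- t / u v) *\<^sub>R (- (u v *\<^sub>R v)) \<in> C"
        using v(2) \<open>- (u v *\<^sub>R v) \<in> C\<close> by (intro convex_cone_scaleR[OF cone]) (simp_all add: divide_nonpos_pos)
      then show ?thesis using v(2) by simp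
    qed
    moreover have "v \<noteq> 0" using v(1) S(3) by blast
    ultimately show False using C unfolding strictly_convex_cone_def by blast
  qed
  moreover have "closed (convex hull S)"
    using S(2) by (simp add: finite_imp_compact_convex_hull compact_imp_closed)
  ultimately obtain a b where "0 < b" "\<forall>x\<in>convex hull S. a \<bullet> x > b"
    using separating_hyperplane_closed_0[of "convex hull S"] by auto
  then have "\<forall>x\<in>S. a \<bullet> x > 0" using hull_inc[of _ S convex] by force
  then show ?thesis ..
qed

section \<open>Primitive generators of simplicial cones\<close>

text \<open>The extremal rays of a simplicial cone are the rays through its generators: a generator is
  exposed by the functional that vanishes on it and is 1 on the others, and a vector with two
  positive coefficients is a proper sum, so it spans no face.  A lattice vector without shorter
  lattice points is determined by its ray.\<close>

lemma primitive_generators_simplicial: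
  fixes B :: "(real^'m) set"
  assumes ind: "independent B" and lat: "B \<subseteq> lattice_points"
    and prim: "\<And>b t. b \<in> B \<Longrightarrow> 0 < t \<Longrightarrow> t < 1 \<Longrightarrow> t *\<^sub>R b \<notin> lattice_points"
  shows "primitive_generators (convex_cone hull B) = B"
proof -
  let ?\<sigma> = "convex_cone hull B"
  have fin: "finite B" using ind by (rule independent_imp_finite)
  have cone: "x \<in> ?\<sigma> \<longleftrightarrow> (\<exists>c. (\<forall>b\<in>B. 0 \<le> c b) \<and> x = (\<Sum>b\<in>B. c b *\<^sub>R b))" for x
    using convex_cone_hull_image_iff[OF fin, of x id] by simp
  have ray: "x \<in> convex_cone hull {v} \<longleftrightarrow> (\<exists>r\<ge>0. x = r *\<^sub>R v)" for x v :: "real^'m"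
  proof -
    have "(\<exists>r\<ge>0. x = r *\<^sub>R v) \<longleftrightarrow> (\<exists>c :: real^'m \<Rightarrow> real. 0 \<le> c v \<and> x = c v *\<^sub>R v)"
    proof
      assume "\<exists>r\<ge>0. x = r *\<^sub>R v"
      then obtain r where "r \<ge> 0" "x = r *\<^sub>R v" by blast
      then show "\<exists>c :: real^'m \<Rightarrow> real. 0 \<le> c v \<and> x = c v *\<^sub>R v"
        by (intro exI[of _ "\<lambda>_. r"]) simp
    qed blast
    then show ?thesis using convex_cone_hull_image_iff[of "{v}" x id] by simp
  qed
  have face: "convex_cone hull {b} face_of ?\<sigma>" if b: "b \<in> B" for b
  proof -
    \<comment> \<open>this functional is nonnegative on the cone and vanishes exactly on the ray through \<open>b\<close>\<close>
    obtain u where u: "\<forall>v\<in>B. u \<bullet> v = (if v = b then 0 else 1)"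
      using independent_dual_vector[OF ind, of "\<lambda>v. if v = b then 0 else 1"] by blast
    have ux: "u \<bullet> (\<Sum>v\<in>B. c v *\<^sub>R v) = (\<Sum>v\<in>B-{b}. c v)" for c
    proof -
      have "u \<bullet> (\<Sum>v\<in>B. c v *\<^sub>R v) = (\<Sum>v\<in>B. if v = b then 0 else c v)"
        unfolding inner_sum_right using u by (intro sum.cong) auto
      also have "\<dots> = (\<Sum>v\<in>B-{b}. c v)"
        using fin b by (simp add: sum.remove[of B b])
      finally show ?thesis .
    qed
    have "(?\<sigma> \<inter> {x. u \<bullet> x = 0}) face_of ?\<sigma>"
      by (rule face_of_Int_supporting_hyperplane_ge)
         (auto simp: convex_convex_cone_hull cone ux intro!: sum_nonneg)
    moreover have "?\<sigma> \<inter> {x. u \<bullet> x = 0} = convex_cone hull {b}"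
    proof (intro equalityI subsetI)
      fix x assume "x \<in> ?\<sigma> \<inter> {x. u \<bullet> x = 0}"
      then obtain c where c: "\<forall>v\<in>B. 0 \<le> c v" and x: "x = (\<Sum>v\<in>B. c v *\<^sub>R v)" and "u \<bullet> x = 0"
        by (auto simp: cone)
      then have "(\<Sum>v\<in>B-{b}. c v) = 0" by (simp add: ux)
      then have "\<forall>v\<in>B-{b}. c v = 0"
        using c fin by (subst (asm) sum_nonneg_eq_0_iff) auto
      then have "x = c b *\<^sub>R b"
        unfolding x using fin b by (subst sum.remove[of B b]) auto
      then show "x \<in> convex_cone hull {b}" using c b by (auto simp: ray)
    next
      fix x assume x: "x \<in> convex_cone hull {b}"
      then have "x \<in> ?\<sigma>" using b hull_mono[of "{b}" B convex_cone] by auto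
      with x u b show "x \<in> ?\<sigma> \<inter> {x. u \<bullet> x = 0}" by (auto simp: ray)
    qed
    ultimately show ?thesis by simp
  qed
  have b0: "b \<noteq> 0" if "b \<in> B" for b
    using that ind dependent_zero by blast
  show ?thesis
  proof (intro equalityI subsetI)
    fix b assume "b \<in> B"
    then show "b \<in> primitive_generators ?\<sigma>"
      unfolding primitive_generators_def using lat prim face b0 by auto
  next
    fix v assume v: "v \<in> primitive_generators ?\<sigma>"
    then have vl: "v \<in> lattice_points" and v0: "v \<noteq> 0" and vf: "convex_cone hull {v} face_of ?\<sigma>"
      and vp: "\<And>t. 0 < t \<Longrightarrow> t < 1 \<Longrightarrow> t *\<^sub>R v \<notin> lattice_points"
      by (auto simp: primitive_generators_def)
    have "v \<in> ?\<sigma>" using face_of_imp_subset[OF vf] hull_inc[of v "{v}" convex_cone] by auto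
    then obtain c where c: "\<forall>b\<in>B. 0 \<le> c b" and vc: "v = (\<Sum>b\<in>B. c b *\<^sub>R b)" by (auto simp: cone)
    obtain b where b: "b \<in> B" "c b \<noteq> 0"
      using v0 vc by (metis (no_types, lifting) scale_eq_0_iff sum.neutral)
    then have cb: "c b > 0" using c by force
    define y where "y = (\<Sum>a\<in>B-{b}. c a *\<^sub>R a)"
    have vy: "v = c b *\<^sub>R b + y" unfolding vc y_def using fin b by (simp add: sum.remove)
    \<comment> \<open>the ray through \<open>v\<close> is a face, so it contains both summands of \<open>v = c b b + y\<close>\<close>
    have cbb: "c b *\<^sub>R b \<in> convex_cone hull {v}"
    proof (cases "c b *\<^sub>R b = y")
      case True
      then have "c b *\<^sub>R b = (1/2) *\<^sub>R v" unfolding vy by (simp flip: scaleR_2)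
      then show ?thesis unfolding ray by (intro exI[of _ "1/2"]) simp
    next
      case False
      have y: "y \<in> ?\<sigma>"
      proof -
        have "y = (\<Sum>a\<in>B. (if a = b then 0 else c a) *\<^sub>R a)"
          unfolding y_def using fin b by (subst sum.remove[of B b]) (auto intro!: sum.cong)
        then show ?thesis unfolding cone
          using c by (intro exI[of _ "\<lambda>a. if a = b then 0 else c a"]) auto
      qed
      have cb': "c b *\<^sub>R b \<in> ?\<sigma>" using b cb by (simp add: convex_cone_hull_mul hull_inc)
      have "(1/2) *\<^sub>R v \<in> open_segment (c b *\<^sub>R b) y"
        unfolding in_segment using False
        by (intro conjI exI[of _ "1/2"]) (simp_all add: vy scaleR_add_right)
      moreover have "(1/2) *\<^sub>R v \<in> convex_cone hull {v}"
        unfolding ray by (intro exI[of _ "1/2"]) simp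
      ultimately show ?thesis using vf cb' y unfolding face_of_def by blast
    qed
    then obtain r where r: "r \<ge> 0" "c b *\<^sub>R b = r *\<^sub>R v" by (auto simp: ray)
    define s where "s = r / c b"
    have bs: "b = s *\<^sub>R v"
    proof -
      have "b = (1 / c b) *\<^sub>R (c b *\<^sub>R b)" using cb by simp
      then show ?thesis unfolding r(2) s_def by simp
    qed
    have s0: "s > 0" using bs b0[OF b(1)] r(1) cb by (metis divide_nonneg_pos less_eq_real_def s_def scale_zero_left)
    have "\<not> s < 1" using vp[of s] s0 bs lat b by auto
    moreover have "\<not> s > 1"
    proof
      assume "s > 1"
      then have "(1/s) *\<^sub>R b \<notin> lattice_points" using prim[OF b(1), of "1/s"] by simp
      moreover have "(1/s) *\<^sub>R b = v" unfolding bs using s0 by simp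
      ultimately show False using vl by simp
    qed
    ultimately have "s = 1" by simp
    then show "v \<in> B" using bs b by simp
  qed
qed

section \<open>Circuits and their triangulations\<close>

text \<open>A configuration of points whose only affine dependence, up to scaling, is \<open>d\<close>, with full
  support.  The last two assumptions say that \<open>d\<close> has at least two positive and two negative
  entries; in this form they apply directly in the arguments below.\<close>

locale circuit =
  fixes e :: "'n::finite \<Rightarrow> 'a::euclidean_space" and d :: "'n \<Rightarrow> real"
  assumes d_nonzero: "d i \<noteq> 0"
    and sum_d: "sum d UNIV = 0"
    and d_relation: "(\<Sum>i\<in>UNIV. d i *\<^sub>R e i) = 0"
    and relation_unique: "\<lbrakk>sum c UNIV = 0; (\<Sum>i\<in>UNIV. c i *\<^sub>R e i) = 0\<rbrakk> \<Longrightarrow> \<exists>t. \<forall>i. c i = t * d i"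
    and another_pos: "\<exists>i. i \<noteq> j \<and> d i > 0"
    and another_neg: "\<exists>i. i \<noteq> j \<and> d i < 0"
begin

lemma relation_eqD:
  assumes "sum c UNIV = sum c' UNIV" "(\<Sum>i\<in>UNIV. c i *\<^sub>R e i) = (\<Sum>i\<in>UNIV. c' i *\<^sub>R e i)"
  obtains t where "\<And>i. c i = c' i + t * d i"
proof -
  have "\<exists>t. \<forall>i. c i - c' i = t * d i"
    using assms by (intro relation_unique) (auto simp: sum_subtractf scaleR_diff_left)
  then show ?thesis using that by (metis add.commute diff_add_cancel)
qed

lemma inj_e: "inj e"
proof (rule injI, rule ccontr)
  fix i j assume eq: "e i = e j" and ij: "i \<noteq> j"
  \<comment> \<open>two equal vectors give a relation that vanishes at every third index, and there is one\<close>
  define c where "c = (\<lambda>k. (if k = i then 1 else 0) - (if k = j then 1 else 0 :: real))"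
  have "sum c UNIV = 0" by (simp add: c_def sum_subtractf)
  moreover have "(\<Sum>k\<in>UNIV. c k *\<^sub>R e k) = 0"
    by (simp add: c_def scaleR_diff_left sum_subtractf eq if_distrib[of "\<lambda>a. a *\<^sub>R _"] cong: if_cong)
  ultimately obtain t where t: "\<forall>k. c k = t * d k" using relation_unique by blast
  obtain k l where "k \<noteq> i" "d k > 0" "l \<noteq> i" "d l < 0" using another_pos another_neg by meson
  then have "\<exists>k. k \<noteq> i \<and> k \<noteq> j" by (metis less_asym)
  then obtain k where "k \<noteq> i" "k \<noteq> j" by blast
  then have "c k = 0" by (simp add: c_def)
  then have "t * d k = 0" using t by simp
  then have "t = 0" using d_nonzero by simp
  then have "c i = 0" using t by simp
  then show False using ij by (simp add: c_def)
qed

text \<open>Otherwise the circuit would have a single entry of one of the two signs.\<close>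

lemma not_in_hull_others: "e j \<notin> convex hull (e ` (- {j}))"
proof
  assume "e j \<in> convex hull (e ` (- {j}))"
  then obtain c where c: "\<forall>i. 0 \<le> c i" "c j = 0" "sum c UNIV = 1" "e j = (\<Sum>i\<in>UNIV. c i *\<^sub>R e i)"
    by (auto simp: convex_hull_image_iff)
  obtain t where t: "\<And>i. c i = (if i = j then 1 else 0) + t * d i"
    using c(3,4) by (rule_tac relation_eqD[of c "\<lambda>i. if i = j then 1 else 0"])
      (auto simp: if_distrib[of "\<lambda>a. a *\<^sub>R _"] cong: if_cong)
  have t0: "t \<noteq> 0" using t[of j] c(2) by auto
  obtain k l where k: "k \<noteq> j" "d k > 0" and l: "l \<noteq> j" "d l < 0"
    using another_pos another_neg by meson
  have "0 \<le> t * d k" "0 \<le> t * d l" using t[of k] t[of l] k l c(1) by (metis add_0)+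
  then show False using t0 k l by (auto simp: zero_le_mult_iff)
qed

lemma vertex_extreme: "e j extreme_point_of (convex hull (range e))"
proof -
  have "range e = insert (e j) (e ` (- {j}))" by auto
  then show ?thesis
    using extreme_point_of_convex_hull_insert[OF _ not_in_hull_others, of j] by simp
qed

text \<open>An extreme point of \<open>P\<close> stays extreme in every convex subset of \<open>P\<close> that contains it.
  This rules out a point \<open>e j\<close> in a cone that it does not generate.\<close>

lemma vertex_in_hull_subsetD:
  assumes "e j \<in> convex hull S" "S \<subseteq> convex hull (range e)"
  shows "e j \<in> S"
proof -
  have "convex hull S \<subseteq> convex hull (range e)" using assms(2) by (simp add: hull_minimal)
  then have "e j extreme_point_of (convex hull S)"
    using vertex_extreme[of j] assms(1) unfolding extreme_point_of_def by blast
  then show ?thesis by (rule extreme_point_of_convex_hull)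
qed

lemma affine_independent_others: "\<not> affine_dependent (e ` (- {j}))"
proof
  assume "affine_dependent (e ` (- {j}))"
  then obtain u i where u: "sum u (e ` (- {j})) = 0" "i \<noteq> j" "u (e i) \<noteq> 0"
     "(\<Sum>v\<in>e ` (- {j}). u v *\<^sub>R v) = 0"
    by (auto simp: affine_dependent_explicit_finite)
  define c where "c = (\<lambda>i. if i = j then 0 else u (e i))"
  have inj: "inj_on e (- {j})" using inj_e by (rule inj_on_subset) simp
  have "sum c UNIV = 0"
  proof -
    have "sum c UNIV = sum c (- {j})" by (rule sum.mono_neutral_right) (auto simp: c_def)
    also have "\<dots> = (\<Sum>i\<in>-{j}. u (e i))" by (rule sum.cong) (auto simp: c_def)
    finally show ?thesis using u(1) by (simp add: sum.reindex[OF inj])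
  qed
  moreover have "(\<Sum>i\<in>UNIV. c i *\<^sub>R e i) = 0"
  proof -
    have "(\<Sum>i\<in>UNIV. c i *\<^sub>R e i) = (\<Sum>i\<in>-{j}. c i *\<^sub>R e i)"
      by (rule sum.mono_neutral_right) (auto simp: c_def)
    also have "\<dots> = (\<Sum>i\<in>-{j}. u (e i) *\<^sub>R e i)" by (rule sum.cong) (auto simp: c_def)
    finally show ?thesis using u(4) by (simp add: sum.reindex[OF inj])
  qed
  ultimately obtain t where t: "\<forall>i. c i = t * d i" using relation_unique by blast
  have "t * d j = 0" using t[rule_format, of j] by (simp add: c_def)
  then have "t = 0" using d_nonzero by simp
  then have "c i = 0" using t by simp
  then show False using u by (simp add: c_def)
qed

text \<open>Two representations of a common point differ by a multiple \<open>t d\<close>.  At \<open>i\<close> the first and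
  at \<open>j\<close> the second vanishes, so \<open>d i > 0\<close> and \<open>d j > 0\<close> force \<open>t \<le> 0\<close> and \<open>t \<ge> 0\<close>.\<close>

lemma inter_hulls:
  assumes "d i > 0" "d j > 0"
  shows "convex hull (e ` (- {i})) \<inter> convex hull (e ` (- {j})) = convex hull (e ` (- {i, j}))"
proof (intro equalityI subsetI)
  fix x assume "x \<in> convex hull (e ` (- {i})) \<inter> convex hull (e ` (- {j}))"
  then obtain c c' where c: "\<forall>k. 0 \<le> c k" "c i = 0" "sum c UNIV = 1" "x = (\<Sum>k\<in>UNIV. c k *\<^sub>R e k)"
    and c': "\<forall>k. 0 \<le> c' k" "c' j = 0" "sum c' UNIV = 1" "x = (\<Sum>k\<in>UNIV. c' k *\<^sub>R e k)"
    by (auto simp: convex_hull_image_iff)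
  obtain t where t: "\<And>k. c k = c' k + t * d k"
    using relation_eqD[of c c'] c c' by auto
  have "c' i + t * d i = 0" "c j = t * d j" using t[of i] t[of j] c(2) c'(2) by auto
  then have "t * d i \<le> 0" "t * d j \<ge> 0"
    using c(1) c'(1) by (metis add_increasing linorder_linear order_antisym, metis)
  then have "t = 0" using assms by (auto simp: mult_le_0_iff zero_le_mult_iff)
  then have "c j = 0" using \<open>c j = t * d j\<close> by simp
  then show "x \<in> convex hull (e ` (- {i, j}))"
    unfolding convex_hull_image_iff using c by (intro exI[of _ c]) auto
next
  fix x assume "x \<in> convex hull (e ` (- {i, j}))"
  moreover have "e ` (- {i, j}) \<subseteq> e ` (- {i})" "e ` (- {i, j}) \<subseteq> e ` (- {j})" by auto
  ultimately show "x \<in> convex hull (e ` (- {i})) \<inter> convex hull (e ` (- {j}))"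
    by (meson IntI hull_mono subsetD)
qed

lemma union_hulls: "(\<Union>i\<in>{i. d i > 0}. convex hull (e ` (- {i}))) = convex hull (range e)"
proof (intro equalityI subsetI)
  fix x assume "x \<in> (\<Union>i\<in>{i. d i > 0}. convex hull (e ` (- {i})))"
  then show "x \<in> convex hull (range e)"
    by (auto intro: hull_mono[THEN subsetD, rotated])
next
  fix x assume "x \<in> convex hull (range e)"
  then obtain c where c: "\<forall>k. 0 \<le> c k" "sum c UNIV = 1" "x = (\<Sum>k\<in>UNIV. c k *\<^sub>R e k)"
    by (auto simp: convex_hull_image_iff)
  have "finite {i. d i > 0}" "{i. d i > 0} \<noteq> {}" using another_pos by auto
  \<comment> \<open>move along the circuit until the first positive index runs out of weight\<close>
  then obtain i where i: "d i > 0" and least: "\<And>j. d j > 0 \<Longrightarrow> c i / d i \<le> c j / d j"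
    using ex_is_arg_min_if_finite[of "{i. d i > 0}" "\<lambda>i. c i / d i"]
    by (auto simp: is_arg_min_linorder)
  define t where "t = c i / d i"
  have t: "t \<ge> 0" using i c(1) by (simp add: t_def)
  define c' where "c' = (\<lambda>k. c k - t * d k)"
  have "0 \<le> c' k" for k
  proof (cases "d k > 0")
    case True
    then show ?thesis using least[OF True] by (simp add: c'_def t_def pos_le_divide_eq)
  next
    case False
    then have "t * d k \<le> 0" using t by (simp add: mult_nonneg_nonpos)
    then show ?thesis using c(1) by (simp add: c'_def add_increasing order_trans)
  qed
  moreover have "c' i = 0" using i by (simp add: c'_def t_def)
  moreover have "sum c' UNIV = 1"
    using c(2) sum_d by (simp add: c'_def sum_subtractf flip: sum_distrib_left)
  moreover have "x = (\<Sum>k\<in>UNIV. c' k *\<^sub>R e k)"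
    using d_relation
    by (simp add: c'_def c(3) scaleR_diff_left sum_subtractf flip: scaleR_scaleR scaleR_sum_right)
  ultimately have "x \<in> convex hull (e ` (- {i}))"
    unfolding convex_hull_image_iff by (intro exI[of _ c']) auto
  then show "x \<in> (\<Union>i\<in>{i. d i > 0}. convex hull (e ` (- {i})))" using i by blast
qed

text \<open>Passing to \<open>- d\<close> exchanges the two triangulations.\<close>

lemma circuit_uminus: "circuit e (\<lambda>i. - d i)"
proof
  show "\<exists>t. \<forall>i. c i = t * - d i" if "sum c UNIV = 0" "(\<Sum>i\<in>UNIV. c i *\<^sub>R e i) = 0" for c
    using relation_unique[OF that] by (metis minus_mult_minus)
qed (use d_nonzero sum_d d_relation another_pos another_neg in \<open>auto simp: sum_negf\<close>)

end

lemma circuit_triangulates: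
  fixes e :: "'n::finite \<Rightarrow> real^'m"
  assumes "circuit e d" and card: "CARD('n) = CARD('m) + 2"
  shows "triangulates (\<lambda>i. convex hull (e ` (- {i}))) {i. d i > 0} (convex hull (range e))"
proof -
  interpret circuit e d by fact
  have simplex: "int CARD('m) simplex (convex hull (e ` (- {i})))" for i
  proof (rule simplex_convex_hull, intro conjI affine_independent_others)
    have "card (e ` (- {i})) = card (- {i})"
      by (rule card_image, rule inj_on_subset[OF inj_e]) simp
    also have "\<dots> = CARD('n) - 1" by (simp add: Compl_eq_Diff_UNIV card_Diff_singleton)
    finally show "int (card (e ` (- {i}))) = int CARD('m) + 1"
      unfolding card by simp
  qed
  have inj: "inj_on (\<lambda>i. convex hull (e ` (- {i}))) {i. d i > 0}"
  proof (rule inj_onI, rule ccontr)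
    fix i j assume eq: "convex hull (e ` (- {i})) = convex hull (e ` (- {j}))" and ij: "i \<noteq> j"
    have "e j \<in> convex hull (e ` (- {i}))" using ij by (intro hull_inc) auto
    then show False using eq not_in_hull_others by metis
  qed
  have face: "(convex hull (e ` (- {i})) \<inter> convex hull (e ` (- {j}))) face_of (convex hull (e ` (- {i})))"
    if "d i > 0" "d j > 0" for i j
    unfolding inter_hulls[OF that] face_of_convex_hull_affine_independent[OF affine_independent_others]
    by (intro exI[of _ "e ` (- {i, j})"]) auto
  show ?thesis
    unfolding triangulates_def triangulation_def
    using simplex inj face union_hulls by auto
qed

section \<open>Simplicial cones from two independent relations\<close>

lemma sum_over_injective_image:
  fixes e :: "'n::finite \<Rightarrow> 'a"
  assumes "inj e"
  shows "sum f (e ` J) = (\<Sum>i\<in>UNIV. if i \<in> J then f (e i) else 0)"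
proof -
  have "inj_on e J" using assms by (rule inj_on_subset) simp
  then show ?thesis by (simp add: sum.reindex sum.If_cases)
qed

text \<open>The space of all linear relations is now spanned by \<open>d\<close> and by a positive relation \<open>p\<close>.
  The columns \<open>(p i, d i)\<close> form a Gale dual of the vectors \<open>e i\<close>, written in coordinates in
  which the sum of all columns points along the first axis.\<close>

locale gale_basis = circuit e d
  for e :: "'n::finite \<Rightarrow> 'a::euclidean_space" and d +
  fixes p :: "'n \<Rightarrow> real"
  assumes p_pos: "p i > 0"
    and p_relation: "(\<Sum>i\<in>UNIV. p i *\<^sub>R e i) = 0"
    and linear_relation: "(\<Sum>i\<in>UNIV. c i *\<^sub>R e i) = 0 \<Longrightarrow> \<exists>s t. \<forall>i. c i = s * p i + t * d i"
begin

lemma zero_in_hull: "0 \<in> convex hull (range e)"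
  unfolding convex_hull_image_iff
proof (intro exI[of _ "\<lambda>i. p i / sum p UNIV"] conjI)
  have s: "sum p UNIV > 0" using p_pos by (intro sum_pos) auto
  show "\<forall>i. 0 \<le> p i / sum p UNIV" using p_pos s by (simp add: less_imp_le)
  show "(\<Sum>i\<in>UNIV. p i / sum p UNIV) = 1" using s by (simp flip: sum_divide_distrib)
  have "(\<Sum>i\<in>UNIV. (p i / sum p UNIV) *\<^sub>R e i) = (1 / sum p UNIV) *\<^sub>R (\<Sum>i\<in>UNIV. p i *\<^sub>R e i)"
    by (simp add: scaleR_sum_right)
  then show "0 = (\<Sum>i\<in>UNIV. (p i / sum p UNIV) *\<^sub>R e i)" using p_relation by simp
qed auto

lemma independent_cone_generators:
  assumes i: "d i > 0" and k: "d k < 0"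
  shows "independent (e ` (- {i, k}))"
  unfolding independent_explicit
proof (intro conjI allI impI ballI)
  fix u v assume u: "(\<Sum>v\<in>e ` (- {i, k}). u v *\<^sub>R v) = 0" and "v \<in> e ` (- {i, k})"
  then obtain j where j: "v = e j" "j \<noteq> i" "j \<noteq> k" by auto
  define c where "c = (\<lambda>j. if j \<in> - {i, k} then u (e j) else 0)"
  have "(\<Sum>j\<in>UNIV. c j *\<^sub>R e j) = (\<Sum>j\<in>UNIV. if j \<in> - {i, k} then u (e j) *\<^sub>R e j else 0)"
    by (rule sum.cong) (auto simp: c_def)
  then have "(\<Sum>j\<in>UNIV. c j *\<^sub>R e j) = 0"
    using u sum_over_injective_image[OF inj_e, of "\<lambda>v. u v *\<^sub>R v" "- {i, k}"] by simp
  then obtain s t where st: "\<forall>j. c j = s * p j + t * d j" using linear_relation by blast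
  have "s * p i + t * d i = 0" "s * p k + t * d k = 0"
    using st[rule_format, of i] st[rule_format, of k] by (simp_all add: c_def)
  then have "s * (p i * d k - p k * d i) = 0" by algebra
  moreover have "p i * d k - p k * d i < 0"
    using i k p_pos[of i] p_pos[of k] by (smt (verit) mult_pos_neg mult_pos_pos)
  ultimately have "s = 0" by simp
  then have "t = 0" using \<open>s * p i + t * d i = 0\<close> i by simp
  then have "c j = 0" using st \<open>s = 0\<close> by simp
  then show "u v = 0" using j by (simp add: c_def)
qed simp

text \<open>The cones cover the hull, with control on the sum of the coefficients.  Starting from
  convex coefficients \<open>c\<close>, subtract \<open>s p + t d\<close>.  For given \<open>s\<close>, the result is nonnegative iff
  \<open>t \<le> (c i - s p i) / d i\<close> at positive and \<open>t \<ge> (c k - s p k) / d k\<close> at negative indices.  The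
  length of the interval of admissible \<open>t\<close> shrinks as \<open>s\<close> grows; at the value of \<open>s\<close> at which it
  becomes a point, one coefficient of each sign is zero.  The sum of the coefficients decreases
  by \<open>s\<close> times the sum of \<open>p\<close>.\<close>

lemma hull_point_in_cone:
  assumes "x \<in> convex hull (range e)"
  obtains i k c where "d i > 0" "d k < 0" "\<And>j. 0 \<le> c j" "c i = 0" "c k = 0"
    "sum c UNIV \<le> 1" "x = (\<Sum>j\<in>UNIV. c j *\<^sub>R e j)"
proof -
  obtain c where c: "\<forall>k. 0 \<le> c k" "sum c UNIV = 1" "x = (\<Sum>k\<in>UNIV. c k *\<^sub>R e k)"
    using assms by (auto simp: convex_hull_image_iff)
  define A where "A = {i. d i > 0} \<times> {k. d k < 0}"
  \<comment> \<open>\<open>f (i, k)\<close> is the value of \<open>s\<close> at which the bounds on \<open>t\<close> from \<open>i\<close> and \<open>k\<close> meet\<close>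
  define f where "f = (\<lambda>(i, k). (c i / d i - c k / d k) / (p i / d i - p k / d k))"
  have "finite A" "A \<noteq> {}" using another_pos another_neg by (auto simp: A_def)
  then obtain i k where "(i, k) \<in> A" and least: "\<And>i' k'. (i', k') \<in> A \<Longrightarrow> f (i, k) \<le> f (i', k')"
    using ex_is_arg_min_if_finite[of A f] by (auto simp: is_arg_min_linorder)
  then have i: "d i > 0" and k: "d k < 0" by (auto simp: A_def)
  have den: "p i' / d i' - p k' / d k' > 0" if "d i' > 0" "d k' < 0" for i' k'
    using that p_pos[of i'] p_pos[of k'] divide_pos_pos[of "p i'" "d i'"] divide_pos_neg[of "p k'" "d k'"]
    by linarith
  have num: "c i' / d i' - c k' / d k' \<ge> 0" if "d i' > 0" "d k' < 0" for i' k'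
    using that c(1) divide_nonneg_pos[of "c i'" "d i'"] divide_nonneg_neg[of "c k'" "d k'"]
    by (smt (verit))
  define s where "s = f (i, k)"
  have s0: "s \<ge> 0" using den[OF i k] num[OF i k] by (simp add: s_def f_def)
  have gap: "s * (p i' / d i' - p k' / d k') \<le> c i' / d i' - c k' / d k'"
    if "d i' > 0" "d k' < 0" for i' k'
    using least[of i' k'] that den[OF that] by (simp add: s_def f_def A_def pos_le_divide_eq)
  have gap0: "s * (p i / d i - p k / d k) = c i / d i - c k / d k"
    using den[OF i k] by (simp add: s_def f_def)
  define t where "t = (c i - s * p i) / d i"
  have tk: "t = (c k - s * p k) / d k"
    using gap0 by (simp add: t_def diff_divide_distrib right_diff_distrib)
  define c' where "c' = (\<lambda>j. c j - (s * p j + t * d j))"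
  have "0 \<le> c' j" for j
  proof (cases "d j > 0")
    case True
    have "s * (p j / d j) - s * (p k / d k) \<le> c j / d j - c k / d k"
      using gap[OF True k] by (simp add: right_diff_distrib)
    then have "t \<le> (c j - s * p j) / d j" unfolding tk by (simp add: diff_divide_distrib)
    then show ?thesis using True by (simp add: c'_def pos_le_divide_eq)
  next
    case False
    then have j: "d j < 0" using d_nonzero[of j] by simp
    have "s * (p i / d i) - s * (p j / d j) \<le> c i / d i - c j / d j"
      using gap[OF i j] by (simp add: right_diff_distrib)
    then have "t \<ge> (c j - s * p j) / d j" unfolding t_def by (simp add: diff_divide_distrib)
    then show ?thesis using j by (simp add: c'_def neg_divide_le_eq)
  qed
  moreover have "c' i = 0" using i by (simp add: c'_def t_def)
  moreover have "c' k = 0" using k by (simp add: c'_def tk)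
  moreover have "sum c' UNIV \<le> 1"
  proof -
    have "sum c' UNIV = 1 - s * sum p UNIV"
      using c(2) sum_d by (simp add: c'_def sum_subtractf sum.distrib flip: sum_distrib_left)
    moreover have "s * sum p UNIV \<ge> 0"
      using s0 p_pos by (intro mult_nonneg_nonneg sum_nonneg) (auto simp: less_imp_le)
    ultimately show ?thesis by simp
  qed
  moreover have "x = (\<Sum>j\<in>UNIV. c' j *\<^sub>R e j)"
    using d_relation p_relation
    by (simp add: c'_def c(3) scaleR_diff_left scaleR_add_left sum_subtractf sum.distrib
          flip: scaleR_scaleR scaleR_sum_right)
  ultimately show ?thesis using that i k by blast
qed

end

section \<open>Lattice points of the polytope\<close>

text \<open>The vertices of a simplex of the triangulation are among the points \<open>e j\<close>.  Conversely a
  point \<open>e j\<close> in a simplex is extreme in the whole polytope and therefore a vertex of the simplex.\<close>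

lemma mostly_empty_simplices_iff:
  fixes e :: "'n::finite \<Rightarrow> real^'m"
  assumes "circuit e d"
    and union: "(\<Union>i\<in>I. convex hull (e ` (- {i}))) = convex hull (range e)"
  shows "(\<forall>i\<in>I. mostly_empty (convex hull (e ` (- {i})))) \<longleftrightarrow>
    (\<forall>x\<in>lattice_points \<inter> convex hull (range e). x \<in> range e \<or> x = 0)"
proof -
  interpret circuit e d by fact
  show ?thesis
  proof (intro iffI ballI)
    fix x assume me: "\<forall>i\<in>I. mostly_empty (convex hull (e ` (- {i})))"
      and x: "x \<in> lattice_points \<inter> convex hull (range e)"
    then obtain i where "i \<in> I" "x \<in> convex hull (e ` (- {i}))" using union by blast
    then have "x extreme_point_of (convex hull (e ` (- {i}))) \<or> x = 0"
      using me x unfolding mostly_empty_def by blast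
    then show "x \<in> range e \<or> x = 0" by (blast dest: extreme_point_of_convex_hull)
  next
    fix i assume E: "\<forall>x\<in>lattice_points \<inter> convex hull (range e). x \<in> range e \<or> x = 0"
      and i: "i \<in> I"
    have sub: "convex hull (e ` (- {i})) \<subseteq> convex hull (range e)" using union i by blast
    show "mostly_empty (convex hull (e ` (- {i})))"
      unfolding mostly_empty_def
    proof
      fix x assume x: "x \<in> lattice_points \<inter> convex hull (e ` (- {i}))"
      then have "x \<in> range e \<or> x = 0" using E sub by blast
      then show "x extreme_point_of (convex hull (e ` (- {i}))) \<or> x = 0"
      proof
        assume "x \<in> range e"
        then have "x extreme_point_of (convex hull (range e))" using vertex_extreme by blast
        then show ?thesis using x sub unfolding extreme_point_of_def by blast
      qed simp
    qed
  qed
qed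

text \<open>The polytope is the union, over the cones, of the simplices spanned by the generators and
  the origin.  A point \<open>e j\<close> in such a simplex is a generator because it is extreme in the
  polytope.\<close>

lemma terminal_cones_iff:
  fixes e :: "'n::finite \<Rightarrow> real^'m"
  assumes "gale_basis e d p"
  shows "(\<forall>i k. d i > 0 \<longrightarrow> d k < 0 \<longrightarrow>
      (\<exists>u. (\<forall>v\<in>e ` (- {i, k}). u \<bullet> v = 1) \<and>
         (\<forall>x\<in>convex_cone hull (e ` (- {i, k})) \<inter> lattice_points.
            u \<bullet> x \<le> 1 \<longrightarrow> x \<in> e ` (- {i, k}) \<or> x = 0))) \<longleftrightarrow>
    (\<forall>x\<in>lattice_points \<inter> convex hull (range e). x \<in> range e \<or> x = 0)" (is "?T \<longleftrightarrow> ?E")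
proof -
  interpret gale_basis e d p by fact
  have inner1: "u \<bullet> (\<Sum>j\<in>J. c j *\<^sub>R e j) = sum c J" if "\<forall>v\<in>e ` J. u \<bullet> v = 1" for u c J
    using that by (simp add: inner_sum_right)
  show ?thesis
  proof
    assume T: ?T
    show ?E
    proof
      fix x assume x: "x \<in> lattice_points \<inter> convex hull (range e)"
      then obtain i k c where ik: "d i > 0" "d k < 0" and c: "\<And>j. 0 \<le> c j" "c i = 0" "c k = 0"
        "sum c UNIV \<le> 1" "x = (\<Sum>j\<in>UNIV. c j *\<^sub>R e j)"
        using hull_point_in_cone[of x] by blast
      have xc: "x = (\<Sum>j\<in>- {i, k}. c j *\<^sub>R e j)"
        unfolding c(5) using c(2,3) by (intro sum.mono_neutral_right) auto
      have s1: "sum c (- {i, k}) \<le> 1"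
        using c(1,4) sum_mono2[of UNIV "- {i, k}" c] by auto
      have xs: "x \<in> convex_cone hull (e ` (- {i, k}))"
        unfolding convex_cone_hull_image_iff[OF finite]
        by (intro exI[of _ c] conjI xc) (simp add: c(1))
      obtain u where u: "\<forall>v\<in>e ` (- {i, k}). u \<bullet> v = 1"
        "\<forall>x\<in>convex_cone hull (e ` (- {i, k})) \<inter> lattice_points.
           u \<bullet> x \<le> 1 \<longrightarrow> x \<in> e ` (- {i, k}) \<or> x = 0"
        using T[THEN spec, THEN spec, THEN mp, OF ik(1), THEN mp, OF ik(2)]
        by (elim exE conjE) (rule that)
      have "u \<bullet> x \<le> 1" unfolding xc inner1[OF u(1)] by (rule s1)
      then show "x \<in> range e \<or> x = 0" using u(2) xs x by blast
    qed
  next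
    assume E: ?E
    show ?T
    proof (intro allI impI)
      fix i k assume ik: "d i > 0" "d k < 0"
      let ?J = "- {i, k}"
      obtain u where u: "\<forall>v\<in>e ` ?J. u \<bullet> v = 1"
        using independent_dual_vector[OF independent_cone_generators[OF ik], of "\<lambda>_. 1"] by blast
      have "x \<in> e ` ?J \<or> x = 0"
        if x: "x \<in> convex_cone hull (e ` ?J) \<inter> lattice_points" "u \<bullet> x \<le> 1" for x
      proof -
        obtain c where c: "\<forall>j\<in>?J. 0 \<le> c j" "x = (\<Sum>j\<in>?J. c j *\<^sub>R e j)"
          using x(1)[THEN IntD1] unfolding convex_cone_hull_image_iff[OF finite]
          by (elim exE conjE) (rule that)
        have "sum c ?J \<le> 1" using x(2) unfolding c(2) inner1[OF u] .
        then have xh: "x \<in> convex hull (insert 0 (e ` ?J))"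
          unfolding c(2) using c(1) by (intro sum_in_hull_insert_0) auto
        have sub: "insert 0 (e ` ?J) \<subseteq> convex hull (range e)"
          using zero_in_hull by (auto intro: hull_inc)
        then have "convex hull (insert 0 (e ` ?J)) \<subseteq> convex hull (range e)"
          by (simp add: hull_minimal)
        then have "x \<in> convex hull (range e)" using xh by (rule subsetD)
        then have "x \<in> range e \<or> x = 0" using E x(1) by blast
        then show ?thesis using vertex_in_hull_subsetD[OF _ sub] xh by blast
      qed
      then show "\<exists>u. (\<forall>v\<in>e ` ?J. u \<bullet> v = 1) \<and>
           (\<forall>x\<in>convex_cone hull (e ` ?J) \<inter> lattice_points. u \<bullet> x \<le> 1 \<longrightarrow> x \<in> e ` ?J \<or> x = 0)"
        using u by blast
    qed
  qed
qed

section \<open>Relations and primitivity from the kernel of the weight matrix\<close>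

definition minor :: "int^'n^2 \<Rightarrow> 'n \<Rightarrow> 'n \<Rightarrow> int" where
  "minor W j k = W $ 1 $ j * W $ 2 $ k - W $ 1 $ k * W $ 2 $ j"

text \<open>Cramer's linear dependence between the columns \<open>j\<close>, \<open>k\<close>, \<open>l\<close> of \<open>W\<close>.\<close>

definition pluecker_vector :: "int^'n^2 \<Rightarrow> 'n \<Rightarrow> 'n \<Rightarrow> 'n \<Rightarrow> int^'n::finite" where
  "pluecker_vector W j k l = (\<chi> i. (if i = j then minor W k l else 0) +
     (if i = k then minor W l j else 0) + (if i = l then minor W j k else 0))"

lemma pluecker_vector_kernel: "W *v pluecker_vector W j k l = 0"
proof -
  have coord: "(W *v pluecker_vector W j k l) $ r =
      W $ r $ j * minor W k l + W $ r $ k * minor W l j + W $ r $ l * minor W j k" for r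
    by (simp add: matrix_vector_mult_def pluecker_vector_def distrib_left sum.distrib
          if_distrib[of "\<lambda>a. _ * a"] cong: if_cong)
  show ?thesis
    unfolding vec_eq_iff forall_2 by (simp add: coord minor_def algebra_simps)
qed

lemma kernel_pairing:
  assumes "kernel_basis W M" "W *v x = 0"
  obtains y :: "int^'m" where "\<And>i. x $ i = (\<Sum>k\<in>UNIV. M $ i $ k * y $ k)"
proof -
  obtain y :: "int^'m" where "x = (\<Sum>k\<in>UNIV. y $ k *s column k M)"
    using assms unfolding kernel_basis_def by blast
  then have "x $ i = (\<Sum>k\<in>UNIV. M $ i $ k * y $ k)" for i
    by (simp add: column_def mult.commute)
  then show ?thesis using that by blast
qed

lemma evec_row_relation:
  assumes "kernel_basis W M"
  shows "(\<Sum>i\<in>UNIV. real_of_int (W $ r $ i) *\<^sub>R evec M i) = 0"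
proof -
  have "(\<Sum>i\<in>UNIV. W $ r $ i * M $ i $ k) = 0" for k
  proof -
    have "(W *v column k M) $ r = 0" using assms by (simp add: kernel_basis_def)
    then show ?thesis by (simp add: matrix_vector_mult_def column_def)
  qed
  then have "(\<Sum>i\<in>UNIV. real_of_int (W $ r $ i) * real_of_int (M $ i $ k)) = 0" for k
    by (metis (mono_tags, lifting) of_int_0 of_int_mult of_int_sum sum.cong)
  then show ?thesis by (simp add: vec_eq_iff evec_def row_def)
qed

text \<open>A real relation between the rows of \<open>M\<close> is orthogonal to the columns of \<open>M\<close>, hence to the
  whole integral kernel of \<open>W\<close>, hence to the vectors \<open>pluecker_vector W j k l\<close>.  Each of these
  determines \<open>c j\<close> from \<open>c k\<close> and \<open>c l\<close>.\<close>

lemma relation_in_row_space: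
  fixes M :: "int^'m^'n"
  assumes basis: "kernel_basis W M" and minor: "minor W k l \<noteq> 0"
    and c: "(\<Sum>i\<in>UNIV. c i *\<^sub>R evec M i) = 0"
  shows "\<exists>u v. \<forall>j. c j = u * real_of_int (W $ 1 $ j) + v * real_of_int (W $ 2 $ j)"
proof -
  have orth: "(\<Sum>i\<in>UNIV. c i * real_of_int (x $ i)) = 0" if x: "W *v x = 0" for x
  proof -
    obtain y :: "int^'m" where y: "\<And>i. x $ i = (\<Sum>k\<in>UNIV. M $ i $ k * y $ k)"
      using kernel_pairing[OF basis x] by blast
    have ck: "(\<Sum>i\<in>UNIV. c i * real_of_int (M $ i $ k)) = 0" for k
      using arg_cong[OF c, of "\<lambda>v. v $ k"] by (simp add: evec_def row_def)
    have "(\<Sum>i\<in>UNIV. c i * real_of_int (x $ i)) =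
        (\<Sum>i\<in>UNIV. \<Sum>k\<in>UNIV. (c i * real_of_int (M $ i $ k)) * real_of_int (y $ k))"
      by (simp add: y sum_distrib_left mult.assoc)
    also have "\<dots> = (\<Sum>k\<in>UNIV. (\<Sum>i\<in>UNIV. c i * real_of_int (M $ i $ k)) * real_of_int (y $ k))"
      by (subst sum.swap) (simp add: sum_distrib_right)
    finally show ?thesis by (simp add: ck)
  qed
  define D where "D = real_of_int (minor W k l)"
  have D: "D \<noteq> 0" using minor by (simp add: D_def)
  have pl: "c j * D + c k * real_of_int (minor W l j) + c l * real_of_int (minor W j k) = 0" for j
  proof -
    have "c j * D + c k * real_of_int (minor W l j) + c l * real_of_int (minor W j k) =
        (\<Sum>i\<in>UNIV. c i * real_of_int (pluecker_vector W j k l $ i))"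
      by (simp add: pluecker_vector_def D_def distrib_left sum.distrib
          if_distrib[of "\<lambda>a. _ * a"] if_distrib[of real_of_int] cong: if_cong)
    then show ?thesis using orth[OF pluecker_vector_kernel] by simp
  qed
  define u where "u = c k * real_of_int (W $ 2 $ l) - c l * real_of_int (W $ 2 $ k)"
  define v where "v = c l * real_of_int (W $ 1 $ k) - c k * real_of_int (W $ 1 $ l)"
  have "c j = (u / D) * real_of_int (W $ 1 $ j) + (v / D) * real_of_int (W $ 2 $ j)" for j
  proof -
    have "c j * D = u * real_of_int (W $ 1 $ j) + v * real_of_int (W $ 2 $ j)"
      using pl[of j] by (simp add: minor_def u_def v_def algebra_simps)
    then have "c j = (u * real_of_int (W $ 1 $ j) + v * real_of_int (W $ 2 $ j)) / D"
      using D by (simp add: eq_divide_eq)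
    then show ?thesis by (simp add: add_divide_distrib)
  qed
  then show ?thesis by blast
qed

lemma well_formed_Gcd_minors:
  "well_formed W \<Longrightarrow> Gcd {minor W k l | k l. k \<noteq> i \<and> l \<noteq> i \<and> k \<noteq> l} = 1"
  by (simp add: well_formed_def minor_def)

lemma well_formed_minor_nonzero:
  assumes "well_formed W"
  obtains k l where "k \<noteq> i" "l \<noteq> i" "k \<noteq> l" "minor W k l \<noteq> 0"
proof -
  let ?A = "{minor W k l | k l. k \<noteq> i \<and> l \<noteq> i \<and> k \<noteq> l}"
  have "\<not> ?A \<subseteq> {0}"
    using well_formed_Gcd_minors[OF assms, of i] Gcd_0_iff[of ?A] by simp
  then show ?thesis using that by blast
qed

lemma evec_in_lattice: "evec M i \<in> lattice_points"
  by (simp add: evec_def lattice_points_def)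

text \<open>If \<open>t e j\<close> is a lattice point, then \<open>t x j\<close> is an integer for every \<open>x\<close> in the integral
  kernel of \<open>W\<close>.  The vectors \<open>pluecker_vector W j k l\<close> have the minors of \<open>W\<close> without column
  \<open>j\<close> as their \<open>j\<close>-th entries, and these have greatest common divisor one, so \<open>t\<close> is an integer.\<close>

lemma evec_primitive:
  fixes M :: "int^'m^'n"
  assumes basis: "kernel_basis W M" and wf: "well_formed W" and t: "0 < t" "t < 1"
  shows "t *\<^sub>R evec M j \<notin> lattice_points"
proof
  assume "t *\<^sub>R evec M j \<in> lattice_points"
  then have tM: "t * real_of_int (M $ j $ s) \<in> \<int>" for s
    by (simp add: lattice_points_def evec_def row_def)
  let ?A = "{minor W k l | k l. k \<noteq> j \<and> l \<noteq> j \<and> k \<noteq> l}"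
  have A: "t * real_of_int m \<in> \<int>" if m_mem: "m \<in> ?A" for m
  proof -
    obtain k l where m: "m = minor W k l" "k \<noteq> j" "l \<noteq> j" using m_mem by blast
    obtain y :: "int^'m" where y: "\<And>i. pluecker_vector W j k l $ i = (\<Sum>k\<in>UNIV. M $ i $ k * y $ k)"
      using kernel_pairing[OF basis pluecker_vector_kernel] by blast
    have "m = (\<Sum>k\<in>UNIV. M $ j $ k * y $ k)"
      using y[of j] m by (simp add: pluecker_vector_def)
    then have "t * real_of_int m = (\<Sum>k\<in>UNIV. (t * real_of_int (M $ j $ k)) * real_of_int (y $ k))"
      by (simp add: sum_distrib_left mult.assoc)
    also have "\<dots> \<in> \<int>" by (intro Ints_sum Ints_mult[OF tM] Ints_of_int)
    finally show ?thesis .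
  qed
  obtain k l where "k \<noteq> j" "l \<noteq> j" "k \<noteq> l" and m0: "minor W k l \<noteq> 0"
    using well_formed_minor_nonzero[OF wf] by blast
  then have mem: "minor W k l \<in> ?A" by blast
  define m where "m = minor W k l"
  obtain z where z: "t * real_of_int m = real_of_int z"
    using A[OF mem] unfolding m_def Ints_def by auto
  have "m dvd z * m'" if m'_mem: "m' \<in> ?A" for m'
  proof -
    obtain z' where "t * real_of_int m' = real_of_int z'"
      using A[OF m'_mem] unfolding Ints_def by auto
    then have "real_of_int (z * m') = real_of_int (m * z')"
      using z by (simp flip: z)
    then have "z * m' = m * z'" by (simp only: of_int_eq_iff)
    then show ?thesis by simp
  qed
  then have "m dvd Gcd ((*) z ` ?A)" by (intro Gcd_greatest) auto
  then have "m dvd z"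
    unfolding Gcd_mult well_formed_Gcd_minors[OF wf] by simp
  then obtain q where "z = m * q" ..
  then have "t = real_of_int q" using z m0 by (simp add: m_def)
  then show False using t by simp
qed

section \<open>The relations of a weight matrix\<close>

text \<open>The determinant of the \<open>i\<close>-th column and \<open>\<omega>\<close>.\<close>

definition slope :: "int^'n^2 \<Rightarrow> 'n::finite \<Rightarrow> real" where
  "slope W i = real_of_int (W $ 1 $ i * sum_b W - W $ 2 $ i * sum_a W)"

lemma s_plus_slope: "s_plus W = {i. slope W i > 0}"
  unfolding s_plus_def slope_def by (simp only: of_int_0_less_iff)

lemma s_minus_slope: "s_minus W = {i. slope W i < 0}"
  unfolding s_minus_def slope_def by (simp only: of_int_less_0_iff)

lemma omega_components [simp]:
  "omega W $ 1 = real_of_int (sum_a W)" "omega W $ 2 = real_of_int (sum_b W)"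
  by (simp_all add: omega_def)

lemma weight_component [simp]: "weight W i $ r = real_of_int (W $ r $ i)"
  by (simp add: weight_def)

lemma sum_slope: "sum (slope W) UNIV = 0"
proof -
  have "sum (slope W) UNIV =
      real_of_int ((\<Sum>i\<in>UNIV. W $ 1 $ i) * sum_b W - (\<Sum>i\<in>UNIV. W $ 2 $ i) * sum_a W)"
    by (simp add: slope_def sum_subtractf sum_distrib_right)
  then show ?thesis by (simp add: sum_a_def sum_b_def mult.commute)
qed

lemma weighted_slope:
  "(\<Sum>i\<in>J. l i * slope W i) =
     (\<Sum>i\<in>J. l i *\<^sub>R weight W i) $ 1 * real_of_int (sum_b W) -
     (\<Sum>i\<in>J. l i *\<^sub>R weight W i) $ 2 * real_of_int (sum_a W)"
  by (simp add: slope_def right_diff_distrib sum_subtractf sum_distrib_right mult.assoc)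

text \<open>A positive combination of columns equal to \<open>\<omega>\<close> must balance columns on both sides of the
  line through \<open>\<omega>\<close>.\<close>

lemma A_omega_signs:
  assumes J: "J \<in> A_omega W" and nz: "\<And>i. slope W i \<noteq> 0" and omega: "omega W \<noteq> 0"
  shows "(\<exists>i\<in>J. slope W i > 0) \<and> (\<exists>k\<in>J. slope W k < 0)"
proof -
  obtain l where l: "\<forall>i\<in>J. l i > (0::real)" "omega W = (\<Sum>i\<in>J. l i *\<^sub>R weight W i)"
    using J by (auto simp: A_omega_def open_cone_def)
  have 0: "(\<Sum>i\<in>J. l i * slope W i) = 0"
    unfolding weighted_slope l(2)[symmetric] by simp
  have ne: "J \<noteq> {}" using l(2) omega by auto
  have "\<exists>i\<in>J. slope W i > 0"
  proof (rule ccontr)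
    assume "\<not> (\<exists>i\<in>J. slope W i > 0)"
    then have "\<forall>i\<in>J. slope W i < 0" using nz by (meson linorder_neqE_linordered_idom)
    then have "(\<Sum>i\<in>J. - (l i * slope W i)) > 0"
      using ne l(1) by (intro sum_pos) (auto simp: mult_pos_neg)
    then show False using 0 by (simp add: sum_negf)
  qed
  moreover have "\<exists>i\<in>J. slope W i < 0"
  proof (rule ccontr)
    assume "\<not> (\<exists>i\<in>J. slope W i < 0)"
    then have "\<forall>i\<in>J. slope W i > 0" using nz by (meson linorder_neqE_linordered_idom)
    then have "(\<Sum>i\<in>J. l i * slope W i) > 0"
      using ne l(1) by (intro sum_pos) auto
    then show False using 0 by simp
  qed
  ultimately show ?thesis by blast
qed

text \<open>Some positive combination of the two columns lies on the line through \<open>\<omega>\<close>; the functional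
  \<open>a\<close>, positive on the columns, shows that it is on the same side of the origin as \<open>\<omega>\<close>.\<close>

lemma pair_in_A_omega:
  assumes a: "\<And>i. a \<bullet> weight W i > 0" "a \<bullet> omega W > 0"
    and i: "slope W i > 0" and k: "slope W k < 0"
  shows "{i, k} \<in> A_omega W"
proof -
  define q where "q = (a \<bullet> weight W i) / slope W i - (a \<bullet> weight W k) / slope W k"
  define r where "r = (a \<bullet> omega W) / q"
  define l where "l = (\<lambda>j. if j = i then r / slope W i else - r / slope W k)"
  have ik: "i \<noteq> k" using i k by auto
  have "q > 0"
    unfolding q_def using a(1)[of i] a(1)[of k] i k
      divide_pos_pos[of "a \<bullet> weight W i" "slope W i"] divide_pos_neg[of "a \<bullet> weight W k" "slope W k"]
    by linarith
  then have r: "r > 0" using a(2) by (simp add: r_def)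
  have l: "l i > 0" "l k > 0" using r i k ik by (auto simp: l_def divide_pos_neg)
  define x where "x = (\<Sum>j\<in>{i, k}. l j *\<^sub>R weight W j)"
  have "(\<Sum>j\<in>{i, k}. l j * slope W j) = 0" using ik i k by (simp add: l_def)
  then have det: "x $ 1 * real_of_int (sum_b W) = x $ 2 * real_of_int (sum_a W)"
    unfolding weighted_slope x_def by simp
  have "a \<bullet> x = r * q"
    using ik by (simp add: x_def inner_add_right l_def q_def algebra_simps)
  then have ax: "a \<bullet> x = a \<bullet> omega W" using \<open>q > 0\<close> by (simp add: r_def)
  let ?\<pi> = "a \<bullet> omega W"
  have pi: "?\<pi> = a $ 1 * real_of_int (sum_a W) + a $ 2 * real_of_int (sum_b W)"
    by (simp add: inner_vec_def sum_2)
  have ax': "a $ 1 * x $ 1 + a $ 2 * x $ 2 = ?\<pi>" using ax by (simp add: inner_vec_def sum_2)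
  have "?\<pi> * x $ 1 = ?\<pi> * real_of_int (sum_a W)"
    using det ax' unfolding pi by algebra
  moreover have "?\<pi> * x $ 2 = ?\<pi> * real_of_int (sum_b W)"
    using det ax' unfolding pi by algebra
  ultimately have "omega W = x" using a(2) by (simp add: vec_eq_iff forall_2)
  then show ?thesis
    unfolding A_omega_def open_cone_def x_def using l by (auto intro!: exI[of _ l])
qed

lemma S_plus_S_minus_dim:
  shows "(\<forall>i. slope W i \<noteq> 0) \<Longrightarrow> vec.dim (S_plus W) = card {i. slope W i > 0}"
    and "(\<forall>i. slope W i \<noteq> 0) \<Longrightarrow> vec.dim (S_minus W) = card {i. slope W i < 0}"
proof -
  assume nz: "\<forall>i. slope W i \<noteq> 0"
  have sl: "slope W i = - real_of_int (sum_a W * W $ 2 $ i - sum_b W * W $ 1 $ i)" for i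
    by (simp add: slope_def algebra_simps)
  have "(sum_a W * W $ 2 $ i - sum_b W * W $ 1 $ i > 0) \<longleftrightarrow> i \<notin> {i. slope W i > 0}" for i
    using nz[rule_format, of i] unfolding sl mem_Collect_eq by linarith
  then have "S_plus W = {z. \<forall>i. i \<notin> {i. slope W i > 0} \<longrightarrow> z $ i = 0}"
    unfolding S_plus_def by simp
  then show "vec.dim (S_plus W) = card {i. slope W i > 0}" by (simp only: dim_substandard_cart)
  have "(sum_a W * W $ 2 $ i - sum_b W * W $ 1 $ i < 0) \<longleftrightarrow> i \<notin> {i. slope W i < 0}" for i
    using nz[rule_format, of i] unfolding sl mem_Collect_eq by linarith
  then have "S_minus W = {z. \<forall>i. i \<notin> {i. slope W i < 0} \<longrightarrow> z $ i = 0}"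
    unfolding S_minus_def by simp
  then show "vec.dim (S_minus W) = card {i. slope W i < 0}" by (simp only: dim_substandard_cart)
qed

lemma slope_nonzero:
  assumes "weight W i \<noteq> 0" "\<not> (\<exists>c::real. omega W = c *\<^sub>R weight W i)"
  shows "slope W i \<noteq> 0"
proof
  assume s: "slope W i = 0"
  let ?a = "real_of_int (sum_a W)" and ?b = "real_of_int (sum_b W)"
  have det: "weight W i $ 1 * ?b = weight W i $ 2 * ?a" using s by (simp add: slope_def)
  have "weight W i $ 1 \<noteq> 0 \<or> weight W i $ 2 \<noteq> 0"
    using assms(1) by (simp add: vec_eq_iff forall_2)
  then show False
  proof
    assume n: "weight W i $ 1 \<noteq> 0"
    have "omega W = (?a / weight W i $ 1) *\<^sub>R weight W i"
      unfolding vec_eq_iff forall_2 using n det by (simp add: field_simps)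
    then show False using assms(2) by blast
  next
    assume n: "weight W i $ 2 \<noteq> 0"
    have "omega W = (?b / weight W i $ 2) *\<^sub>R weight W i"
      unfolding vec_eq_iff forall_2 using n det by (simp add: field_simps)
    then show False using assms(2) by blast
  qed
qed

text \<open>By the description of the relations through the rows of \<open>W\<close>, linear relations between the
  \<open>e i\<close> are the functions \<open>f (D i)\<close> for linear functionals \<open>f\<close> on the plane.  Here \<open>slope\<close> and
  the functional \<open>a\<close> are a basis of these, as \<open>slope\<close> vanishes at \<open>\<omega>\<close> and \<open>a\<close> does not.\<close>

lemma weight_matrix_gale_basis:
  fixes W :: "int^'n^2" and M :: "int^'m^'n"
  assumes basis: "kernel_basis W M" and wf: "well_formed W"
    and nz: "\<And>i. slope W i \<noteq> 0"
    and two: "card {i. slope W i > 0} \<ge> 2" "card {i. slope W i < 0} \<ge> 2"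
    and a: "\<And>i. a \<bullet> weight W i > 0"
  shows "gale_basis (evec M) (slope W) (\<lambda>i. a \<bullet> weight W i)"
proof -
  let ?a = "real_of_int (sum_a W)" and ?b = "real_of_int (sum_b W)"
  let ?p = "\<lambda>i. a \<bullet> weight W i"
  have row: "(\<Sum>i\<in>UNIV. real_of_int (W $ r $ i) *\<^sub>R evec M i) = 0" for r
    by (rule evec_row_relation[OF basis])
  have comb: "(\<Sum>i\<in>UNIV. (u * real_of_int (W $ 1 $ i) + v * real_of_int (W $ 2 $ i)) *\<^sub>R evec M i) = 0"
    for u v
    using row by (simp add: scaleR_add_left sum.distrib flip: scaleR_scaleR scaleR_sum_right)
  have p: "?p i = a $ 1 * real_of_int (W $ 1 $ i) + a $ 2 * real_of_int (W $ 2 $ i)" for i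
    by (simp add: inner_vec_def sum_2)
  have d: "slope W i = ?b * real_of_int (W $ 1 $ i) + (- ?a) * real_of_int (W $ 2 $ i)" for i
    by (simp add: slope_def)
  define q where "q = a $ 1 * ?a + a $ 2 * ?b"
  have "q = sum ?p UNIV"
    by (simp add: q_def p sum.distrib sum_a_def sum_b_def flip: sum_distrib_left)
  also have "\<dots> > 0" using a by (intro sum_pos) auto
  finally have q: "q > 0" .
  have lin: "\<exists>s t. \<forall>i. c i = s * ?p i + t * slope W i"
    if c: "(\<Sum>i\<in>UNIV. c i *\<^sub>R evec M i) = 0" for c
  proof -
    obtain k l where "minor W k l \<noteq> 0" using well_formed_minor_nonzero[OF wf] by blast
    then obtain u v where uv: "\<forall>j. c j = u * real_of_int (W $ 1 $ j) + v * real_of_int (W $ 2 $ j)"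
      using relation_in_row_space[OF basis _ c] by blast
    \<comment> \<open>Cramer's rule for the change of basis, whose determinant is \<open>- q\<close>\<close>
    define x where "x = u * ?a + v * ?b"
    define y where "y = u * a $ 2 - v * a $ 1"
    have "c i = (x / q) * ?p i + (y / q) * slope W i" for i
    proof -
      have "c i * q = x * ?p i + y * slope W i"
        unfolding uv[rule_format] p d q_def x_def y_def by algebra
      then have "c i = (x * ?p i + y * slope W i) / q"
        using q by (simp add: eq_divide_eq)
      then show ?thesis by (simp add: add_divide_distrib)
    qed
    then show ?thesis by blast
  qed
  have another: "\<exists>i. i \<noteq> j \<and> i \<in> S" if "card S \<ge> 2" for j and S :: "'n set"
  proof (rule ccontr)
    assume "\<nexists>i. i \<noteq> j \<and> i \<in> S"
    then have "S \<subseteq> {j}" by auto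
    then have "card S \<le> 1" using card_mono[of "{j}" S] by simp
    then show False using that by simp
  qed
  show ?thesis
  proof unfold_locales
    show "slope W i \<noteq> 0" for i by (rule nz)
    show "sum (slope W) UNIV = 0" by (rule sum_slope)
    show "(\<Sum>i\<in>UNIV. slope W i *\<^sub>R evec M i) = 0" unfolding d by (rule comb)
    show "\<exists>i. i \<noteq> j \<and> slope W i > 0" for j using another[OF two(1), of j] by simp
    show "\<exists>i. i \<noteq> j \<and> slope W i < 0" for j using another[OF two(2), of j] by simp
    show "?p i > 0" for i by (rule a)
    show "(\<Sum>i\<in>UNIV. ?p i *\<^sub>R evec M i) = 0" unfolding p by (rule comb)
    show "\<exists>s t. \<forall>i. c i = s * ?p i + t * slope W i" if "(\<Sum>i\<in>UNIV. c i *\<^sub>R evec M i) = 0" for c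
      by (rule lin[OF that])
    show "\<exists>t. \<forall>i. c i = t * slope W i" if c0: "sum c UNIV = 0" and c: "(\<Sum>i\<in>UNIV. c i *\<^sub>R evec M i) = 0" for c
    proof -
      obtain s t where st: "\<forall>i. c i = s * ?p i + t * slope W i" using lin[OF c] by blast
      have "sum c UNIV = s * sum ?p UNIV + t * sum (slope W) UNIV"
        by (simp add: st sum.distrib sum_distrib_left)
      then have "s * q = 0" using c0 by (simp add: sum_slope \<open>q = sum ?p UNIV\<close>)
      then show ?thesis using q st by auto
    qed
  qed
qed

section \<open>The top-dimensional cones of the fan\<close>

text \<open>The complement of the index set of a cone contains an index of either sign, and a cone of
  full dimension needs \<open>m = n - 2\<close> generators, so it contains nothing else.\<close>

lemma fan_top_cones:
  fixes W :: "int^'n^2" and M :: "int^'m^'n"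
  assumes card: "CARD('n) = CARD('m) + 2"
    and gale: "gale_basis (evec M) (slope W) (\<lambda>i. a \<bullet> weight W i)"
    and omega_pos: "a \<bullet> omega W > 0"
  shows "\<sigma> \<in> fan_X W M \<and> dim \<sigma> = CARD('m) \<longleftrightarrow>
      (\<exists>i k. slope W i > 0 \<and> slope W k < 0 \<and> \<sigma> = sigma M (- {i, k}))"
proof -
  let ?e = "evec M" and ?d = "slope W"
  interpret gale_basis ?e ?d "\<lambda>i. a \<bullet> weight W i" by (rule gale)
  have card2: "card (- {i, k}) = CARD('m)" if "?d i > 0" "?d k < 0" for i k
  proof -
    have "i \<noteq> k" using that by auto
    then have "card (UNIV - {i, k}) = CARD('n) - 2" by (simp add: card_Diff_subset)
    then show ?thesis using card by (simp add: Compl_eq_Diff_UNIV)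
  qed
  show ?thesis
  proof
    assume L: "\<sigma> \<in> fan_X W M \<and> dim \<sigma> = CARD('m)"
    then obtain J where J: "\<sigma> = sigma M J" "- J \<in> A_omega W" by (auto simp: fan_X_def)
    have "omega W \<noteq> 0" using omega_pos by auto
    then obtain i k where ik: "i \<in> - J" "k \<in> - J" "?d i > 0" "?d k < 0"
      using A_omega_signs[OF J(2) d_nonzero] by blast
    have "CARD('m) \<le> card (?e ` J)"
      using L J(1) dim_convex_cone_hull_le[of "?e ` J"] by (simp add: sigma_def)
    also have "\<dots> \<le> card J" by (rule card_image_le) simp
    finally have "card (- {i, k}) \<le> card J" using card2[OF ik(3,4)] by simp
    then have "J = - {i, k}" using ik by (intro card_seteq) auto
    then show "\<exists>i k. ?d i > 0 \<and> ?d k < 0 \<and> \<sigma> = sigma M (- {i, k})" using ik J by blast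
  next
    assume "\<exists>i k. ?d i > 0 \<and> ?d k < 0 \<and> \<sigma> = sigma M (- {i, k})"
    then obtain i k where ik: "?d i > 0" "?d k < 0" and \<sigma>: "\<sigma> = sigma M (- {i, k})" by blast
    have "card (?e ` (- {i, k})) = CARD('m)"
      using card2[OF ik] card_image[OF inj_on_subset[OF inj_e subset_UNIV], of "- {i, k}"] by simp
    moreover have "card (?e ` (- {i, k})) \<le> dim \<sigma>"
      unfolding \<sigma> sigma_def using independent_cone_generators[OF ik]
      by (intro independent_card_le_dim) (simp_all add: hull_subset)
    moreover have "dim \<sigma> \<le> CARD('m)" using dim_subset_UNIV[of \<sigma>] by simp
    ultimately have "dim \<sigma> = CARD('m)" by simp
    moreover have "\<sigma> \<in> fan_X W M"
      unfolding fan_X_def \<sigma> using pair_in_A_omega[OF p_pos omega_pos ik]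
      by (auto intro!: exI[of _ "- {i, k}"])
    ultimately show "\<sigma> \<in> fan_X W M \<and> dim \<sigma> = CARD('m)" by simp
  qed
qed

lemma terminal_iff_hull_lattice_points:
  fixes W :: "int^'n^2" and M :: "int^'m^'n"
  assumes card: "CARD('n) = CARD('m) + 2"
    and gale: "gale_basis (evec M) (slope W) (\<lambda>i. a \<bullet> weight W i)"
    and omega_pos: "a \<bullet> omega W > 0"
    and basis: "kernel_basis W M" and wf: "well_formed W"
  shows "toric_terminal (fan_X W M) \<longleftrightarrow>
    (\<forall>x\<in>lattice_points \<inter> convex hull (range (evec M)). x \<in> range (evec M) \<or> x = 0)"
proof -
  interpret gale_basis "evec M" "slope W" "\<lambda>i. a \<bullet> weight W i" by (rule gale)
  have gens: "primitive_generators (sigma M (- {i, k})) = evec M ` (- {i, k})"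
    if "slope W i > 0" "slope W k < 0" for i k
    unfolding sigma_def
    using independent_cone_generators[OF that] evec_in_lattice evec_primitive[OF basis wf]
    by (intro primitive_generators_simplicial) auto
  define T where "T = (\<lambda>\<sigma> G. \<exists>u. (\<forall>v\<in>G. u \<bullet> v = 1) \<and>
    (\<forall>x\<in>\<sigma> \<inter> lattice_points. u \<bullet> x \<le> 1 \<longrightarrow> x \<in> G \<or> x = (0 :: real^'m)))"
  have "toric_terminal (fan_X W M) \<longleftrightarrow>
      (\<forall>\<sigma>. \<sigma> \<in> fan_X W M \<and> dim \<sigma> = CARD('m) \<longrightarrow> T \<sigma> (primitive_generators \<sigma>))"
    unfolding toric_terminal_def T_def by blast
  also have "\<dots> \<longleftrightarrow> (\<forall>i k. slope W i > 0 \<longrightarrow> slope W k < 0 \<longrightarrow>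
      T (sigma M (- {i, k})) (primitive_generators (sigma M (- {i, k}))))"
    unfolding fan_top_cones[OF card gale omega_pos] by blast
  also have "\<dots> \<longleftrightarrow> (\<forall>i k. slope W i > 0 \<longrightarrow> slope W k < 0 \<longrightarrow>
      T (sigma M (- {i, k})) (evec M ` (- {i, k})))"
    by (simp add: gens)
  finally show ?thesis
    unfolding T_def sigma_def terminal_cones_iff[OF gale] .
qed

section \<open>Triangulation and terminality\<close>

theorem mainTheorem2:
  fixes W :: "int^'n^2" and M :: "int^'m^'n" and I :: "'n set"
  assumes "CARD('n) = CARD('m) + 2"
    and "\<exists>C. strictly_convex_cone C \<and> (\<forall>i. weight W i \<in> C)"
    and "\<forall>i. weight W i \<noteq> 0"
    and "\<forall>i. \<not> (\<exists>c::real. omega W = c *\<^sub>R weight W i)"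
    and "vec.dim (S_plus W) \<ge> 2" and "vec.dim (S_minus W) \<ge> 2"
    and "well_formed W"
    and "kernel_basis W M"
    and "I = s_plus W \<or> I = s_minus W"
  shows "triangulates (Delta M) I (polytope_P M) \<and>
         (toric_terminal (fan_X W M) \<longleftrightarrow> (\<forall>i\<in>I. mostly_empty (Delta M i)))"
proof -
  let ?e = "evec M" and ?P = "convex hull (range (evec M))"
  have nz: "slope W i \<noteq> 0" for i using assms(3,4) slope_nonzero by blast
  obtain C where "strictly_convex_cone C" "\<forall>i. weight W i \<in> C" using assms(2) by blast
  moreover have "0 \<notin> range (weight W)" using assms(3) by (metis rangeE)
  ultimately have "\<exists>a. \<forall>x\<in>range (weight W). a \<bullet> x > 0"
    by (intro strictly_convex_cone_positive_functional[of C]) auto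
  then obtain a where a: "\<And>i. a \<bullet> weight W i > 0" by blast
  have gale: "gale_basis ?e (slope W) (\<lambda>i. a \<bullet> weight W i)"
    using assms(5-8) nz a S_plus_S_minus_dim[of W]
    by (intro weight_matrix_gale_basis) auto
  then interpret gale_basis ?e "slope W" "\<lambda>i. a \<bullet> weight W i" .
  have omega_pos: "a \<bullet> omega W > 0"
  proof -
    have "omega W = (\<Sum>i\<in>UNIV. weight W i)"
      by (simp add: vec_eq_iff forall_2 sum_a_def sum_b_def)
    then show ?thesis using a by (simp add: inner_sum_right sum_pos)
  qed
  have "{?e j | j. j \<noteq> i} = ?e ` (- {i})" for i by auto
  then have Delta: "Delta M = (\<lambda>i. convex hull (?e ` (- {i})))"
    by (simp add: Delta_def fun_eq_iff)
  have P: "polytope_P M = ?P" by (simp add: polytope_P_def)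
  have tri: "triangulates (Delta M) I (polytope_P M)"
    using assms(9)
  proof
    assume "I = s_plus W"
    then show ?thesis
      unfolding Delta P s_plus_slope using circuit_triangulates[OF circuit_axioms assms(1)] by simp
  next
    assume "I = s_minus W"
    then show ?thesis
      unfolding Delta P s_minus_slope using circuit_triangulates[OF circuit_uminus assms(1)] by simp
  qed
  then have union: "(\<Union>i\<in>I. convex hull (?e ` (- {i}))) = ?P"
    by (simp add: triangulates_def P Delta)
  have "(\<forall>i\<in>I. mostly_empty (Delta M i)) \<longleftrightarrow> toric_terminal (fan_X W M)"
    unfolding Delta mostly_empty_simplices_iff[OF circuit_axioms union]
      terminal_iff_hull_lattice_points[OF assms(1) gale omega_pos assms(8,7)] ..
  with tri show ?thesis by blast
qed

end
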